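(* Let $n \le m$, let $A \in \mathbb{R}^{n\times m}$ have full rank $n$, and let $b\in\mathbb{R}^n\setminus\{0\}$ be such that $As=b$ has a solution with all entries nonzero. Let $s\in\mathbb{R}^m$ satisfy $As=b$ and $s_j\neq0$ for all $j$, let $x=|s|$, and let $\rho(x)=\|d(x)\|_\infty$. Then \[ \|s\|_1 - \min\{\|s'\|_1 : As'=b\} \;\le\; \big(1+\rho(x)^{-1}\big)\|s\|_1 - \rho(x)^{-1} f(x). \]
   Context: For $x\in\mathbb{R}^m_{>0}$, $X=\mathrm{diag}(x)$, $L(x)=AXA^\top$, the voltage vector is $d(x)=A^\top L(x)^{-1} b$, and $f(x) = \mathbf{1}^\top x + b^\top L(x)^{-1} b$ (the dissipation potential on the positive orthant). *)

theory Defs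
  imports "HOL-Analysis.Analysis"
begin

definition l1norm :: "real ^ 'm \<Rightarrow> real" where
  "l1norm s = (\<Sum>j\<in>UNIV. \<bar>s $ j\<bar>)"

definition diag :: "real ^ 'm \<Rightarrow> real ^ 'm ^ 'm" where
  "diag x = (\<chi> i j. if i = j then x $ i else 0)"

definition lap :: "real ^ 'm ^ 'n \<Rightarrow> real ^ 'm \<Rightarrow> real ^ 'n ^ 'n" where
  "lap A x = A ** diag x ** transpose A"

text \<open>The next two definitions are meant for positive \<open>x\<close> and \<open>A\<close> of full row rank, where
  \<open>lap A x\<close> is positive definite; outside this domain \<open>matrix_inv\<close> may be a junk value.\<close>

definition voltage :: "real ^ 'm ^ 'n \<Rightarrow> real ^ 'n \<Rightarrow> real ^ 'm \<Rightarrow> real ^ 'm" where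
  "voltage A b x = transpose A *v (matrix_inv (lap A x) *v b)"

definition dissipation :: "real ^ 'm ^ 'n \<Rightarrow> real ^ 'n \<Rightarrow> real ^ 'm \<Rightarrow> real" where
  "dissipation A b x = (\<Sum>j\<in>UNIV. x $ j) + b \<bullet> (matrix_inv (lap A x) *v b)"

end

theory Submission
  imports Defs
begin

text \<open>The voltage \<open>d = transpose A *v p\<close>, with \<open>p\<close> the vector of potentials, satisfies
  \<open>b \<bullet> p = s' \<bullet> d\<close> for every \<open>s'\<close> with \<open>A *v s' = b\<close>, so by Hoelder's inequality
  \<open>d\<close> scaled by \<open>inverse \<rho>\<close> is a dual certificate: \<open>inverse \<rho> * (b \<bullet> p)\<close> bounds the minimum
  from below. Since the entries of \<open>x\<close> sum to \<open>l1norm s\<close>, the right-hand side of the theorem is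
  exactly \<open>l1norm s - inverse \<rho> * (b \<bullet> p)\<close>.\<close>

lemma l1norm_nonneg: "0 \<le> l1norm s"
  by (simp add: l1norm_def sum_nonneg)

lemma inner_le_infnorm_l1norm:
  fixes s d :: "real ^ 'm"
  shows "s \<bullet> d \<le> infnorm d * l1norm s"
proof -
  have "s $ j * d $ j \<le> infnorm d * \<bar>s $ j\<bar>" for j
  proof -
    have "s $ j * d $ j \<le> \<bar>d $ j\<bar> * \<bar>s $ j\<bar>"
      by (metis abs_ge_self abs_mult mult.commute)
    also have "\<dots> \<le> infnorm d * \<bar>s $ j\<bar>"
      by (intro mult_right_mono component_le_infnorm_cart) simp
    finally show ?thesis .
  qed
  then show ?thesis
    by (simp add: inner_vec_def l1norm_def sum_distrib_left sum_mono)
qed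

lemma inner_potential_eq_inner_voltage:
  assumes "A *v s' = b"
  shows "b \<bullet> (matrix_inv (lap A x) *v b) = s' \<bullet> voltage A b x"
  unfolding voltage_def transpose_matrix_vector
  by (metis assms dot_lmul_matrix inner_commute)

lemma inverse_infnorm_voltage_le_l1norm:
  assumes "A *v s' = b"
  shows "inverse (infnorm (voltage A b x)) * (b \<bullet> (matrix_inv (lap A x) *v b)) \<le> l1norm s'"
proof (cases "infnorm (voltage A b x) = 0")
  \<comment> \<open>Since \<open>inverse 0 = 0\<close>, the left-hand side vanishes here.\<close>
  case True
  then show ?thesis by (simp add: l1norm_nonneg)
next
  case False
  then have "infnorm (voltage A b x) > 0"
    using infnorm_pos_le[of "voltage A b x"] by linarith
  then show ?thesis
    using inner_le_infnorm_l1norm[of s' "voltage A b x"]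
    by (simp add: inner_potential_eq_inner_voltage[OF assms] field_simps)
qed

text \<open>Ensures that the \<open>INF\<close> in the theorem is an attained minimum. The feasible
  set may be unbounded, so compactness comes from cutting it down to the sublevel set of
  \<open>l1norm\<close> at \<open>s\<close>.\<close>

lemma l1norm_arg_min_exists:
  fixes A :: "real ^ 'm ^ 'n"
  assumes "A *v s = b"
  shows "\<exists>s0. is_arg_min l1norm (\<lambda>s'. A *v s' = b) s0"
proof -
  define K where "K = {s'. A *v s' = b} \<inter> {s'. l1norm s' \<le> l1norm s}"
  have cont: "continuous_on UNIV (l1norm :: real ^ 'm \<Rightarrow> real)"
    unfolding l1norm_def by (intro continuous_intros)
  have "norm s' \<le> l1norm s" if "s' \<in> K" for s'
    using that norm_le_l1_cart[of s'] by (simp add: K_def l1norm_def)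
  then have "bounded K"
    by (auto simp: bounded_iff)
  moreover have "closed K"
    unfolding K_def
    by (intro closed_Int closed_Collect_eq closed_Collect_le cont continuous_intros
        matrix_vector_mult_linear_continuous_on)
  ultimately have "compact K"
    by (simp add: compact_eq_bounded_closed)
  moreover have "s \<in> K"
    using assms by (simp add: K_def)
  ultimately obtain s0 where s0: "s0 \<in> K" "\<And>s'. s' \<in> K \<Longrightarrow> l1norm s0 \<le> l1norm s'"
    using continuous_attains_inf[of K l1norm] continuous_on_subset[OF cont] by blast
  \<comment> \<open>A feasible \<open>s'\<close> outside \<open>K\<close> has larger
    \<open>l1norm\<close> than \<open>s\<close>, and \<open>s\<close> lies in
    \<open>K\<close>.\<close>
  have "l1norm s0 \<le> l1norm s'" if "A *v s' = b" for s'
    using s0 that \<open>s \<in> K\<close> by (cases "l1norm s' \<le> l1norm s") (force simp: K_def)+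
  then show ?thesis
    using s0(1) by (auto simp: is_arg_min_linorder K_def)
qed

theorem theorem3p8:
  fixes A :: "real ^ 'm ^ 'n" and b :: "real ^ 'n" and s x :: "real ^ 'm" and \<rho> :: real
  assumes "CARD('n) \<le> CARD('m)"
    and "rank A = CARD('n)"
    and "b \<noteq> 0"
    and "\<exists>s0. A *v s0 = b \<and> (\<forall>j. s0 $ j \<noteq> 0)"
    and "A *v s = b" and "\<forall>j. s $ j \<noteq> 0"
    and "x = (\<chi> j. \<bar>s $ j\<bar>)"
    and "\<rho> = infnorm (voltage A b x)"
  shows "(\<exists>s0. is_arg_min l1norm (\<lambda>s'. A *v s' = b) s0) \<and>
    l1norm s - (INF s'\<in>{s'. A *v s' = b}. l1norm s')
      \<le> (1 + inverse \<rho>) * l1norm s - inverse \<rho> * dissipation A b x"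
proof
  show "\<exists>s0. is_arg_min l1norm (\<lambda>s'. A *v s' = b) s0"
    using assms(5) by (rule l1norm_arg_min_exists)
  let ?p = "matrix_inv (lap A x) *v b"
  \<comment> \<open>The dual bound holds at every feasible point, and \<open>s\<close> shows that
    the feasible set is nonempty, as \<open>cINF_greatest\<close> requires.\<close>
  have "inverse \<rho> * (b \<bullet> ?p) \<le> (INF s'\<in>{s'. A *v s' = b}. l1norm s')"
    using assms(5) by (intro cINF_greatest) (auto simp: assms(8) inverse_infnorm_voltage_le_l1norm)
  moreover have "dissipation A b x = l1norm s + b \<bullet> ?p"
    by (simp add: dissipation_def l1norm_def assms(7))
  ultimately show "l1norm s - (INF s'\<in>{s'. A *v s' = b}. l1norm s')
      \<le> (1 + inverse \<rho>) * l1norm s - inverse \<rho> * dissipation A b x"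
    by (simp add: algebra_simps)
qed

end
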